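(* Let $n$ be a positive integer. For $0 \le m \le l \le n$ let $g_n(m,l)$ be the smallest integer $k \ge 0$ such that there exists a cutset $\mathcal{C} \subseteq 2^{[n]}$ containing exactly $k$ subsets of size $i$ for each $m \le i \le l$ and no subsets of any other size. Then: (1) $g_n(m,m)=\binom{n}{m}$ for every integer $0 \le m \le n$; (2) $g_n(m,m+1)=\binom{n-1}{m}$ for every integer $0 \le m \le n-1$; (3) $g_n(m,m+2)=\sum_{j=0}^{m}\binom{n-2j-2}{m-j}$ for every integer $0 \le m \le n/2-1$.
   Context: $[n]=\{1,\dots,n\}$ and $2^{[n]}$ is the set of all subsets of $[n]$ ordered by inclusion. A maximal chain in $2^{[n]}$ is a chain $A_0 \subset A_1 \subset \cdots \subset A_n$ with $|A_i|=i$. A cutset is a collection $\mathcal{C} \subseteq 2^{[n]}$ that meets every maximal chain. The $f$-vector (profile) of $\mathcal{A}\subseteq 2^{[n]}$ is $(f_0,\dots,f_n)$ with $f_i$ the number of members of $\mathcal{A}$ of size $i$; thus $g_n(m,l)$ is the least $k$ such that the vector with $f_i=k$ for $m\le i\le l$ and $f_i=0$ otherwise is the $f$-vector of a cutset. *)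

theory Defs
  imports Complex_Main
begin

definition maximal_chain :: "nat \<Rightarrow> nat set set \<Rightarrow> bool" where
  "maximal_chain n M \<longleftrightarrow>
     (\<exists>A. (\<forall>i\<le>n. A i \<subseteq> {1..n} \<and> card (A i) = i) \<and>
          (\<forall>i<n. A i \<subset> A (Suc i)) \<and>
          M = A ` {0..n})"

definition cutset :: "nat \<Rightarrow> nat set set \<Rightarrow> bool" where
  "cutset n C \<longleftrightarrow> C \<subseteq> Pow {1..n} \<and> (\<forall>M. maximal_chain n M \<longrightarrow> C \<inter> M \<noteq> {})"

definition f_vector :: "nat set set \<Rightarrow> nat \<Rightarrow> nat" where
  "f_vector \<A> i = card {A \<in> \<A>. card A = i}"

(* Meaningful only when m \<le> l \<le> n; an equation about it also asserts that
   an admissible k exists, since LEAST is unspecified otherwise. *)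
definition g :: "nat \<Rightarrow> nat \<Rightarrow> nat \<Rightarrow> nat" where
  "g n m l = (LEAST k. \<exists>C. cutset n C \<and>
     (\<forall>i\<le>n. f_vector C i = (if m \<le> i \<and> i \<le> l then k else 0)))"

end

theory Submission
  imports Defs
begin

text \<open>
  Lower bounds. Let \<open>F\<close> be the family of the \<open>m\<close>-sets outside the cutset. The supersets of its
  members on level \<open>m + 1\<close> that are outside the cutset form a family \<open>G\<close>, and so on; the upper
  shadow of the last family but one lies in the cutset. The Kruskal-Katona theorem, applied to the
  complements, bounds these families from below. It is proved after Frankl: replace the family by
  one that is stable under all shifts towards a point \<open>v\<close>, and induct on the members avoiding and
  containing \<open>v\<close>. For three levels write \<open>n = 2m + r + 2\<close>; then the claimed value is
  \<open>\<Sum>i\<le>m. (2i + r choose i)\<close>, and the cascades that occur are explicit.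

  Upper bounds. For two levels take the \<open>m\<close>-sets avoiding \<open>n\<close> and the \<open>(m + 1)\<close>-sets
  containing \<open>n\<close>. For three levels add two points \<open>v, w\<close> to a ground set \<open>X\<close> with a cutset \<open>C\<close>
  on the levels \<open>m, m + 1, m + 2\<close>, and take the sets \<open>B\<close>, \<open>B \<union> {v}\<close>, \<open>B \<union> {v, w}\<close> for the
  \<open>(m + 1)\<close>-subsets \<open>B\<close> of \<open>X\<close> together with \<open>A \<union> {w}\<close> for \<open>A \<in> C\<close>.
\<close>

section \<open>The Kruskal-Katona theorem\<close>

definition shadow :: "'a set set \<Rightarrow> 'a set set" where
  "shadow F = {B. \<exists>x. x \<notin> B \<and> insert x B \<in> F}"

text \<open>The compression that replaces \<open>y\<close> by \<open>v\<close> in a member unless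
  the result is already a member. It is encoded as a membership test, by cases on the presence of
  \<open>v\<close> and \<open>y\<close>, so that inclusions between shifted families unfold to case
  distinctions.\<close>

definition shift :: "'a \<Rightarrow> 'a \<Rightarrow> 'a set set \<Rightarrow> 'a set set" where
  "shift y v F = {B. if v \<in> B \<and> y \<notin> B then B \<in> F \<or> insert y (B - {v}) \<in> F
     else if y \<in> B \<and> v \<notin> B then B \<in> F \<and> insert v (B - {y}) \<in> F
     else B \<in> F}"

text \<open>\<open>cascade k b N S\<close> says that \<open>N\<close> is a sum of binomials \<open>a\<^sub>i choose i\<close> over
  \<open>i = k, k - 1, \<dots>, s\<close> with \<open>s \<ge> 1\<close>, \<open>b > a\<^sub>k > a\<^sub>k\<^sub>-\<^sub>1 > \<dots>\<close> and \<open>a\<^sub>i \<ge> i\<close>, and that \<open>S\<close> is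
  the sum of the \<open>a\<^sub>i choose (i - 1)\<close>.\<close>

inductive cascade :: "nat \<Rightarrow> nat \<Rightarrow> nat \<Rightarrow> nat \<Rightarrow> bool" where
  empty: "cascade k b 0 0"
| step: "cascade k a N S \<Longrightarrow> Suc k \<le> a \<Longrightarrow> a < b \<Longrightarrow>
    cascade (Suc k) b ((a choose Suc k) + N) ((a choose k) + S)"

lemma cascade_zero: "cascade k b N S \<Longrightarrow> k = 0 \<or> N = 0 \<Longrightarrow> S = 0"
  by (induction rule: cascade.induct) auto

lemma cascade_mono: "cascade k b N S \<Longrightarrow> b \<le> c \<Longrightarrow> cascade k c N S"
  by (erule cascade.cases) (auto intro!: cascade.intros)

text \<open>The bound \<open>b\<close> forces every top entry to equal its index, so each term is 1
  and there are at most \<open>k\<close> of them.\<close>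

lemma cascade_tight: "cascade k b N S \<Longrightarrow> b \<le> Suc k \<Longrightarrow> N \<le> k"
proof (induction rule: cascade.induct)
  case (step k a N S b)
  then have "a = Suc k" by simp
  with step show ?case by simp
qed simp

text \<open>Here \<open>M\<close> is the sum of the \<open>(a\<^sub>i - 1) choose (i - 1)\<close>. In Frankl's argument it is compared
  with the number of members that contain a fixed point; \<open>P, Q\<close> serve for the members that avoid
  the point, \<open>M', S'\<close> for those that contain it. Replacing the terms with \<open>a\<^sub>i = i\<close> by a single 1
  keeps \<open>P\<close> a cascade.\<close>

lemma cascade_split:
  assumes "cascade k b N S"
  shows "\<exists>M M' S'. M \<le> N \<and> cascade (k - 1) (b - 1) M' S' \<and> M' \<le> M \<and> S \<le> M + S' \<and>
    (k + 2 \<le> b \<longrightarrow> (\<exists>P Q. cascade k (b - 1) P Q \<and> P \<le> N - M + 1 \<and> M \<le> Q))"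
  using assms
proof (induction rule: cascade.induct)
  case (empty k b)
  show ?case by (rule exI[of _ 0])+ (auto intro: cascade.empty)
next
  case (step k a N S b)
  from step.IH obtain M M' S' where IH: "M \<le> N" "cascade (k - 1) (a - 1) M' S'" "M' \<le> M"
    "S \<le> M + S'" "k + 2 \<le> a \<Longrightarrow> \<exists>P Q. cascade k (a - 1) P Q \<and> P \<le> N - M + 1 \<and> M \<le> Q"
    by blast
  obtain c where a: "a = Suc c" using step.hyps by (cases a) auto
  have ck: "k \<le> c" using step.hyps a by simp
  define M2 where "M2 = (c choose k) + M"
  have M2: "M2 \<le> (a choose Suc k) + N" using IH(1) by (simp add: M2_def a)
  \<comment> \<open>Pascal's rule splits \<open>a choose k\<close> into \<open>c choose k\<close>,
    which is counted in \<open>M2\<close>, and \<open>c choose (k - 1)\<close>, which joins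
    \<open>S'\<close>. For \<open>k = 0\<close> there is no second part, and
    \<open>S = 0\<close>.\<close>
  have low: "\<exists>M' S'. cascade k (b - 1) M' S' \<and> M' \<le> M2 \<and> (a choose k) + S \<le> M2 + S'"
  proof (cases k)
    case 0
    then show ?thesis using IH cascade_zero[OF step.hyps(1)]
      by (intro exI[of _ 0]) (auto intro: cascade.empty simp: M2_def)
  next
    case (Suc j)
    have "cascade (Suc j) (b - 1) ((c choose Suc j) + M') ((c choose j) + S')"
      by (rule cascade.step[of j c]) (use IH Suc a ck step.hyps in auto)
    then show ?thesis using IH Suc by (intro exI conjI) (auto simp: M2_def a)
  qed
  have up: "\<exists>P Q. cascade (Suc k) (b - 1) P Q \<and> P \<le> ((a choose Suc k) + N) - M2 + 1 \<and> M2 \<le> Q"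
    if b: "Suc k + 2 \<le> b"
  proof (cases "k + 2 \<le> a")
    case True
    then obtain P Q where PQ: "cascade k c P Q" "P \<le> N - M + 1" "M \<le> Q" using IH(5) a by auto
    have "cascade (Suc k) (b - 1) ((c choose Suc k) + P) ((c choose k) + Q)"
      by (rule cascade.step[of k c]) (use PQ True a step.hyps in auto)
    then show ?thesis using PQ IH(1) by (intro exI conjI) (auto simp: M2_def a)
  next
    case False
    \<comment> \<open>All terms are 1 here, and lowering \<open>a\<close> would put it below its
      index. A single term with top entry and index \<open>Suc k\<close> replaces them: its value 1
      is paid for by the \<open>+ 1\<close> in the bound on \<open>P\<close>, and its shadow
      \<open>Suc k\<close> is at least \<open>M2\<close>.\<close>
    then have ak: "a = Suc k" using step.hyps by simp
    then have "N \<le> k" using cascade_tight step.hyps by blast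
    moreover have "cascade (Suc k) (b - 1) ((Suc k choose Suc k) + 0) ((Suc k choose k) + 0)"
      by (rule cascade.step[of k "Suc k"]) (use b in \<open>auto intro: cascade.empty\<close>)
    ultimately show ?thesis using M2 ak by (intro exI[of _ 1] exI[of _ "Suc k"]) auto
  qed
  show ?case using M2 low up by (metis diff_Suc_1)
qed

section \<open>Shifting and shadows\<close>

text \<open>For a removed point \<open>x\<close> other than \<open>v\<close> and \<open>y\<close>,
  removing \<open>x\<close> commutes with exchanging \<open>y\<close> and \<open>v\<close>. If
  \<open>x\<close> is one of the two, the set that remains or its exchanged form is reached by
  removing the other one where needed.\<close>

lemma shadow_shift:
  assumes "v \<noteq> y"
  shows "shadow (shift y v F) \<subseteq> shift y v (shadow F)"
proof
  fix B assume "B \<in> shadow (shift y v F)"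
  then obtain x where x: "x \<notin> B" "insert x B \<in> shift y v F" by (auto simp: shadow_def)
  have I: "\<And>x B. x \<notin> B \<Longrightarrow> insert x B \<in> F \<Longrightarrow> B \<in> shadow F" by (auto simp: shadow_def)
  consider "v \<in> B" "y \<in> B" | "v \<notin> B" "y \<notin> B" | "v \<in> B" "y \<notin> B" | "v \<notin> B" "y \<in> B" by blast
  then show "B \<in> shift y v (shadow F)"
  proof cases
    case 1
    then show ?thesis using x I by (auto simp: shift_def)
  next
    case 2
    then show ?thesis using x I[of x B] I[of y B] assms by (auto simp: shift_def split: if_splits)
  next
    case 3
    have "x \<noteq> y \<Longrightarrow> insert y (insert x B - {v}) = insert x (insert y (B - {v}))" using 3 x by auto
    then show ?thesis using 3 x I[of x B] I[of x "insert y (B - {v})"] assms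
      by (auto simp: shift_def split: if_splits)
  next
    case 4
    have 5: "x \<noteq> v \<Longrightarrow> insert v (insert x B - {y}) = insert x (insert v (B - {y}))" using 4 x by auto
    have 6: "insert y (insert v (B - {y})) = insert v B" using 4 by auto
    show ?thesis using 4 x 5 6 I[of x B] I[of x "insert v (B - {y})"] I[of y "insert v (B - {y})"] assms
      by (auto simp: shift_def split: if_splits)
  qed
qed

text \<open>Links the membership test to the usual map that moves single members; both the
  cardinality and the finiteness of the shifted family come from it.\<close>

lemma bij_betw_shift:
  assumes "v \<noteq> y"
  defines "P \<equiv> \<lambda>A F. y \<in> A \<and> v \<notin> A \<and> insert v (A - {y}) \<notin> F"
  shows "bij_betw (\<lambda>A. if P A F then insert v (A - {y}) else A) F (shift y v F)"
    (is "bij_betw ?f _ _")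
proof (rule bij_betw_imageI)
  have inv: "insert y (insert v (A - {y}) - {v}) = A" if "P A F" for A
    using that by (auto simp: P_def)
  have inv': "insert v (insert y (A - {v}) - {y}) = A" if "v \<in> A" "y \<notin> A" for A
    using that by auto
  show "inj_on ?f F"
  proof (rule inj_onI)
    fix A B assume AB: "A \<in> F" "B \<in> F" "?f A = ?f B"
    \<comment> \<open>Whether a member was moved can be read off its image, since exactly the moved
      ones land outside \<open>F\<close>.\<close>
    have *: "?f A \<in> F \<longleftrightarrow> \<not> P A F" if "A \<in> F" for A using that by (simp add: P_def)
    have PAB: "P A F \<longleftrightarrow> P B F" using *[OF AB(1)] *[OF AB(2)] unfolding AB(3) by argo
    show "A = B"
    proof (cases "P A F")
      case True
      then have "P B F" using PAB by simp
      then have "insert v (A - {y}) = insert v (B - {y})" using True AB(3) by simp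
      then show ?thesis using inv[OF True] inv[OF \<open>P B F\<close>] by simp
    next
      case False
      then have "\<not> P B F" using PAB by simp
      then show ?thesis using False AB(3) by simp
    qed
  qed
  show "?f ` F = shift y v F"
  proof (intro equalityI subsetI)
    fix B assume "B \<in> ?f ` F"
    then obtain A where A: "A \<in> F" "B = ?f A" by blast
    show "B \<in> shift y v F"
    proof (cases "P A F")
      case True
      then have "B = insert v (A - {y})" using A by simp
      moreover from this have "insert y (B - {v}) \<in> F" using inv[OF True] A(1) by simp
      ultimately show ?thesis using assms(1) by (simp add: shift_def)
    next
      case False
      then have "B = A" using A(2) by simp
      then have B: "B \<in> F" "\<not> P B F" using A(1) False by simp_all
      then have "y \<in> B \<and> v \<notin> B \<Longrightarrow> insert v (B - {y}) \<in> F" unfolding P_def by blast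
      then show ?thesis using B by (simp add: shift_def)
    qed
  next
    fix B assume B: "B \<in> shift y v F"
    show "B \<in> ?f ` F"
    proof (cases "B \<in> F")
      case True
      then have "\<not> P B F" using B True by (auto simp: shift_def P_def split: if_splits)
      then show ?thesis using True by (intro image_eqI[of _ _ B]) simp_all
    next
      case False
      then have vB: "v \<in> B" "y \<notin> B" "insert y (B - {v}) \<in> F"
        using B by (auto simp: shift_def split: if_splits)
      then have "P (insert y (B - {v})) F" using inv'[of B] False assms(1) by (simp add: P_def)
      then have "?f (insert y (B - {v})) = B" using inv'[of B] vB by simp
      then show ?thesis using vB by (intro image_eqI[of _ _ "insert y (B - {v})"]) simp_all
    qed
  qed
qed

lemma finite_shadow:
  assumes "finite X" "F \<subseteq> Pow X"
  shows "finite (shadow F)"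
  by (rule finite_subset[of _ "Pow X"]) (use assms in \<open>auto simp: shadow_def\<close>)

lemma card_shift: "v \<noteq> y \<Longrightarrow> card (shift y v F) = card F"
  using bij_betw_same_card[OF bij_betw_shift] by metis

lemma shift_props:
  assumes "v \<noteq> y" "v \<in> X" "finite X" "F \<subseteq> Pow X" "\<forall>A\<in>F. card A = k"
  shows "shift y v F \<subseteq> Pow X" "\<forall>A\<in>shift y v F. card A = k"
    "card (shadow (shift y v F)) \<le> card (shadow F)"
proof -
  have "A \<subseteq> X \<and> card A = k" if "A \<in> shift y v F" for A
  proof (cases "A \<in> F")
    case False
    then have A: "v \<in> A" "y \<notin> A" "insert y (A - {v}) \<in> F"
      using that by (auto simp: shift_def split: if_splits)
    then have 1: "insert y (A - {v}) \<subseteq> X" "card (insert y (A - {v})) = k" using assms by auto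
    then have fA: "finite A" using assms(3) by (metis finite_Diff_insert finite_insert finite_subset Diff_empty)
    then have "card A = k" using 1 A
      by (metis Diff_iff card.remove card_insert_disjoint finite_Diff)
    then show ?thesis using 1 A assms by auto
  qed (use assms in auto)
  then show "shift y v F \<subseteq> Pow X" "\<forall>A\<in>shift y v F. card A = k" by auto
  have fin: "finite (shadow F)" using assms finite_shadow by blast
  have "finite (shift y v (shadow F))"
    using bij_betw_finite[OF bij_betw_shift[OF assms(1)]] fin by metis
  then have "card (shadow (shift y v F)) \<le> card (shift y v (shadow F))"
    using shadow_shift[OF assms(1)] by (intro card_mono) auto
  then show "card (shadow (shift y v F)) \<le> card (shadow F)" by (simp add: card_shift[OF assms(1)])
qed

text \<open>Each shift that changes the family in this way turns a member avoiding \<open>v\<close>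
  into one containing it, so the number of members avoiding \<open>v\<close> drops and the process
  ends.\<close>

lemma exists_shifted:
  assumes "v \<in> X" "finite X" "F \<subseteq> Pow X" "\<forall>A\<in>F. card A = k"
  shows "\<exists>G. G \<subseteq> Pow X \<and> (\<forall>A\<in>G. card A = k) \<and> card G = card F \<and>
    card (shadow G) \<le> card (shadow F) \<and>
    (\<forall>A\<in>G. \<forall>y\<in>A. v \<notin> A \<longrightarrow> insert v (A - {y}) \<in> G)"
  using assms(3,4)
proof (induction "card {A \<in> F. v \<notin> A}" arbitrary: F rule: less_induct)
  case less
  show ?case
  proof (cases "\<forall>A\<in>F. \<forall>y\<in>A. v \<notin> A \<longrightarrow> insert v (A - {y}) \<in> F")
    case True
    then show ?thesis using less.prems by blast
  next
    case False
    then obtain A y where A: "A \<in> F" "y \<in> A" "v \<notin> A" "insert v (A - {y}) \<notin> F" by blast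
    then have vy: "v \<noteq> y" by auto
    have "{B \<in> shift y v F. v \<notin> B} \<subseteq> {B \<in> F. v \<notin> B} - {A}"
      using A by (auto simp: shift_def split: if_splits)
    moreover have fin: "finite {B \<in> F. v \<notin> B}"
      using less.prems assms(2) by (auto intro: finite_subset[of _ "Pow X"])
    ultimately have "card {B \<in> shift y v F. v \<notin> B} \<le> card ({B \<in> F. v \<notin> B} - {A})"
      by (intro card_mono) auto
    also have "\<dots> < card {B \<in> F. v \<notin> B}" using fin A by (intro psubset_card_mono) auto
    finally have lt: "card {B \<in> shift y v F. v \<notin> B} < card {B \<in> F. v \<notin> B}" .
    note sp = shift_props[OF vy assms(1,2) less.prems]
    from less.hyps[OF lt sp(1,2)] sp(3) card_shift[OF vy, of F] show ?thesis
      by (metis (no_types, lifting) le_trans)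
  qed
qed

lemma kruskal_katona:
  assumes "finite X" "F \<subseteq> Pow X" "\<forall>A\<in>F. card A = k" "cascade k b N S" "N \<le> card F"
  shows "S \<le> card (shadow F)"
  using assms
proof (induction "card X" arbitrary: X F k b N S)
  case 0
  then have X: "X = {}" by simp
  then have "F \<subseteq> {{}}" using 0 by auto
  then have "k = 0 \<or> F = {}" using 0 by (metis card.empty subset_singletonD singletonI)
  then have "S = 0" using cascade_zero[OF 0(5)] 0 by auto
  then show ?case by simp
next
  case (Suc c)
  show ?case
  proof (cases "k = 0")
    case True
    then have "S = 0" using cascade_zero Suc.prems by blast
    then show ?thesis by simp
  next
    case False
    then obtain j where k: "k = Suc j" by (cases k) auto
    obtain v where v: "v \<in> X" using Suc(2) by fastforce
    define Y where "Y = X - {v}"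
    have Y: "c = card Y" "finite Y" using Suc.hyps(2) Suc.prems(1) v by (auto simp: Y_def)
    obtain G where G: "G \<subseteq> Pow X" "\<forall>A\<in>G. card A = k" "card G = card F"
      "card (shadow G) \<le> card (shadow F)"
      "\<forall>A\<in>G. \<forall>y\<in>A. v \<notin> A \<longrightarrow> insert v (A - {y}) \<in> G"
      using exists_shifted[OF v Suc.prems(1-3)] by blast
    have finG: "finite G" using G(1) Suc.prems(1) by (metis finite_Pow_iff finite_subset)
    define G0 where "G0 = {A \<in> G. v \<notin> A}"
    define G1 where "G1 = {A. v \<notin> A \<and> insert v A \<in> G}"
    have G0: "G0 \<subseteq> Pow Y" "\<forall>A\<in>G0. card A = k" using G(1,2) by (auto simp: G0_def Y_def)
    have G1Y: "G1 \<subseteq> Pow Y" using G(1) by (auto simp: G1_def Y_def)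
    have G1c: "\<forall>A\<in>G1. card A = j"
    proof
      fix A assume "A \<in> G1"
      moreover from this have "finite A" using G1Y Y(2) by (meson PowD finite_subset subsetD)
      ultimately show "card A = j" using G(2) k by (force simp: G1_def)
    qed
    have inj: "inj_on (insert v) {A. v \<notin> A}" by (auto simp: inj_on_def)
    have cG1: "card (insert v ` G1) = card G1"
      by (rule card_image) (rule inj_on_subset[OF inj], auto simp: G1_def)
    have "G = G0 \<union> insert v ` G1"
    proof (intro equalityI subsetI)
      fix A assume A: "A \<in> G"
      show "A \<in> G0 \<union> insert v ` G1"
      proof (cases "v \<in> A")
        case True
        then have "A = insert v (A - {v})" by auto
        moreover have "A - {v} \<in> G1" using A True by (simp add: G1_def insert_absorb)
        ultimately show ?thesis by blast
      qed (use A in \<open>auto simp: G0_def\<close>)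
    qed (auto simp: G0_def G1_def)
    moreover have "G0 \<inter> insert v ` G1 = {}" by (auto simp: G0_def)
    ultimately have cG: "card G = card G0 + card G1"
      using finG cG1 by (metis card_Un_disjoint finite_Un)
    \<comment> \<open>Deleting \<open>y\<close> from a member of \<open>G0\<close> and adding
      \<open>v\<close> is a shift, and \<open>G\<close> is stable under it.\<close>
    have sub0: "shadow G0 \<subseteq> G1"
    proof
      fix B assume "B \<in> shadow G0"
      then obtain y where y: "y \<notin> B" "insert y B \<in> G" "v \<notin> insert y B" by (auto simp: shadow_def G0_def)
      then have "insert v (insert y B - {y}) \<in> G" using G(5) by blast
      then show "B \<in> G1" using y by (simp add: G1_def)
    qed
    have finG1: "finite G1" using G1Y Y(2) by (metis finite_Pow_iff finite_subset)
    \<comment> \<open>Enlarging the bound makes the premise \<open>k + 2 \<le> b\<close> for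
      \<open>P\<close> and \<open>Q\<close> in \<open>cascade_split\<close> available.\<close>
    have "cascade k (max b (k + 2)) N S" using cascade_mono[OF Suc.prems(4)] by simp
    from cascade_split[OF this] obtain M M' S' P Q where sp: "M \<le> N"
      "cascade (k - 1) (max b (k + 2) - 1) M' S'" "M' \<le> M" "S \<le> M + S'"
      "cascade k (max b (k + 2) - 1) P Q" "P \<le> N - M + 1" "M \<le> Q" by auto
    \<comment> \<open>If the link were smaller than \<open>M\<close>, then \<open>G0\<close> would
      have at least \<open>N - M + 1\<close> members, hence at least \<open>P\<close>, and its
      shadow, which lies in \<open>G1\<close>, would already have \<open>Q \<ge> M\<close>
      members.\<close>
    have M: "M \<le> card G1"
    proof (rule ccontr)
      assume "\<not> M \<le> card G1"
      then have "P \<le> card G0" using sp cG G(3) Suc.prems(5) by linarith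
      then have "Q \<le> card (shadow G0)" using Suc.hyps(1)[OF Y G0 sp(5)] by blast
      also have "\<dots> \<le> card G1" using sub0 finG1 by (rule card_mono[rotated])
      finally show False using sp \<open>\<not> M \<le> card G1\<close> by simp
    qed
    have S': "S' \<le> card (shadow G1)"
      using Suc.hyps(1)[OF Y G1Y G1c, of _ M' S'] sp M k by auto
    have fs: "finite (shadow G)" using finite_shadow[OF Suc.prems(1) G(1)] .
    have "card (insert v ` shadow G1) = card (shadow G1)"
      by (rule card_image) (rule inj_on_subset[OF inj], auto simp: G1_def shadow_def)
    moreover have "G1 \<union> insert v ` shadow G1 \<subseteq> shadow G"
    proof -
      have "insert v B \<in> shadow G" if "x \<notin> B" "insert x B \<in> G1" for x B
        using that by (auto simp: shadow_def G1_def insert_commute intro!: exI[of _ x])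
      moreover have "A \<in> shadow G" if "A \<in> G1" for A using that by (auto simp: shadow_def G1_def)
      ultimately show ?thesis by (auto simp: shadow_def[of G1])
    qed
    moreover have "G1 \<inter> insert v ` shadow G1 = {}" by (auto simp: G1_def)
    moreover have "finite (shadow G1)" using finite_shadow[OF Y(2) G1Y] .
    ultimately have "card G1 + card (shadow G1) \<le> card (shadow G)"
      using finG1 fs by (metis card_Un_disjoint card_mono finite_imageI)
    then show ?thesis using M S' sp(4) G(4) by linarith
  qed
qed

definition upshadow :: "'a set \<Rightarrow> 'a set set \<Rightarrow> 'a set set" where
  "upshadow X F = {B. B \<subseteq> X \<and> (\<exists>x\<in>B. B - {x} \<in> F)}"

text \<open>Complementation in \<open>X\<close> turns adding a point into deleting one, which is why
  the cascade has index \<open>card X - m\<close>.\<close>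

lemma kruskal_katona_up:
  assumes "finite X" "F \<subseteq> Pow X" "\<forall>A\<in>F. card A = m"
    and "cascade (card X - m) b N S" "N \<le> card F"
  shows "S \<le> card (upshadow X F)"
proof -
  define G where "G = (\<lambda>A. X - A) ` F"
  have "inj_on (\<lambda>A. X - A) F" using assms(2) by (auto simp: inj_on_def)
  then have cG: "card G = card F" unfolding G_def by (rule card_image)
  have G: "G \<subseteq> Pow X" by (auto simp: G_def)
  have "card (X - A) = card X - m" if "A \<in> F" for A
    using that assms(1-3) by (metis PowD card_Diff_subset finite_subset subsetD)
  then have "\<forall>A\<in>G. card A = card X - m" by (auto simp: G_def)
  then have "S \<le> card (shadow G)" using kruskal_katona assms G cG by metis
  also have "shadow G \<subseteq> (\<lambda>A. X - A) ` upshadow X F"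
  proof
    fix C assume "C \<in> shadow G"
    then obtain x A where x: "x \<notin> C" "insert x C = X - A" "A \<in> F" by (auto simp: shadow_def G_def)
    have "X - C - {x} = X - insert x C" by auto
    also have "\<dots> = A" using x assms(2) by auto
    finally have "X - C \<in> upshadow X F" using x by (auto simp: upshadow_def intro!: bexI[of _ x])
    moreover have "C = X - (X - C)" using x by auto
    ultimately show "C \<in> (\<lambda>A. X - A) ` upshadow X F" by blast
  qed
  moreover have fin: "finite (upshadow X F)"
    by (rule finite_subset[of _ "Pow X"]) (use assms(1) in \<open>auto simp: upshadow_def\<close>)
  ultimately have "S \<le> card ((\<lambda>A. X - A) ` upshadow X F)"
    by (meson card_mono finite_imageI le_trans)
  then show ?thesis using card_image_le[OF fin] le_trans by blast
qed

section \<open>Cutsets\<close>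

text \<open>The initial segments of an enumeration of the ground set form a maximal chain.\<close>

lemma cutset_list:
  assumes "cutset n C" "distinct xs" "set xs = {1..n}"
  shows "\<exists>i\<le>n. set (take i xs) \<in> C"
proof -
  define A where "A = (\<lambda>i. set (take i xs))"
  have len: "length xs = n" using assms(2,3) distinct_card by fastforce
  have card: "card (A i) = i" if "i \<le> n" for i
    using that len assms(2) by (simp add: A_def distinct_card)
  have "A i \<subset> A (Suc i)" if "i < n" for i
  proof -
    have "A i \<subseteq> A (Suc i)" by (simp add: A_def set_take_subset_set_take)
    moreover have "A i \<noteq> A (Suc i)" using card[of i] card[of "Suc i"] that by auto
    ultimately show ?thesis by blast
  qed
  moreover have "A i \<subseteq> {1..n}" for i using assms(3) set_take_subset A_def by metis
  ultimately have "maximal_chain n (A ` {0..n})" using card unfolding maximal_chain_def by blast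
  then obtain B where "B \<in> C" "B \<in> A ` {0..n}" using assms(1) unfolding cutset_def by blast
  then show ?thesis by (auto simp: A_def)
qed

text \<open>Enumerate \<open>A\<close> first, then \<open>zs\<close>, then the other points. The
  size bounds on \<open>C\<close> force the initial segment that is hit to end within
  \<open>zs\<close>, or directly before it.\<close>

lemma cutset_flag:
  assumes "cutset n C" "\<And>A. A \<in> C \<Longrightarrow> m \<le> card A \<and> card A \<le> m + length zs"
    and "A \<subseteq> {1..n}" "card A = m" "distinct zs" "set zs \<subseteq> {1..n} - A"
  shows "\<exists>j\<le>length zs. A \<union> set (take j zs) \<in> C"
proof -
  have finA: "finite A" using assms(3) finite_subset by blast
  obtain ws where ws: "set ws = A" "distinct ws" using finite_distinct_list[OF finA] by blast
  obtain us where us: "set us = {1..n} - A - set zs" "distinct us"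
    using finite_distinct_list[of "{1..n} - A - set zs"] by auto
  define xs where "xs = ws @ zs @ us"
  have xs: "distinct xs" "set xs = {1..n}" using assms(3,5,6) ws us by (auto simp: xs_def)
  obtain i where i: "i \<le> n" "set (take i xs) \<in> C" using cutset_list[OF assms(1) xs] by blast
  have "length xs = n" using xs distinct_card by fastforce
  then have "card (set (take i xs)) = i" using i xs(1) by (simp add: distinct_card)
  then have im: "m \<le> i" "i \<le> m + length zs" using assms(2) i(2) by force+
  have "length ws = m" using ws assms(4) distinct_card by fastforce
  then have "take i xs = ws @ take (i - m) zs" using im by (simp add: xs_def)
  then show ?thesis using i(2) im ws(1) by (intro exI[of _ "i - m"]) auto
qed

text \<open>Trades the \<open>LEAST\<close> and the f-vector for a witness and a lower bound, both
  phrased by the sizes of members and the exact level counts.\<close>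

lemma g_eqI:
  assumes "l \<le> n" "cutset n C" "\<And>A. A \<in> C \<Longrightarrow> m \<le> card A \<and> card A \<le> l"
    and "\<And>i. m \<le> i \<Longrightarrow> i \<le> l \<Longrightarrow> card {A \<in> C. card A = i} = K"
    and "\<And>C k. cutset n C \<Longrightarrow> (\<And>A. A \<in> C \<Longrightarrow> m \<le> card A \<and> card A \<le> l) \<Longrightarrow>
      (\<And>i. m \<le> i \<Longrightarrow> i \<le> l \<Longrightarrow> card {A \<in> C. card A = i} = k) \<Longrightarrow> K \<le> k"
  shows "g n m l = K"
  unfolding g_def
proof (rule Least_equality)
  have "card {A \<in> C. card A = i} = 0" if "\<not> (m \<le> i \<and> i \<le> l)" for i
  proof -
    have "{A \<in> C. card A = i} = {}" using assms(3) that by auto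
    then show ?thesis by (metis card.empty)
  qed
  then have "f_vector C i = (if m \<le> i \<and> i \<le> l then K else 0)" for i
    using assms(4) by (simp add: f_vector_def)
  then show "\<exists>C. cutset n C \<and> (\<forall>i\<le>n. f_vector C i = (if m \<le> i \<and> i \<le> l then K else 0))"
    using assms(2) by blast
next
  fix k assume "\<exists>C. cutset n C \<and> (\<forall>i\<le>n. f_vector C i = (if m \<le> i \<and> i \<le> l then k else 0))"
  then obtain D where D: "cutset n D" "\<forall>i\<le>n. f_vector D i = (if m \<le> i \<and> i \<le> l then k else 0)"
    by blast
  have sub: "D \<subseteq> Pow {1..n}" using D(1) by (simp add: cutset_def)
  then have fin: "finite D" by (rule finite_subset) simp
  show "K \<le> k"
  proof (rule assms(5)[OF D(1)])
    fix A assume A: "A \<in> D"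
    then have "card A \<le> n" using sub card_mono[of "{1..n}" A] by auto
    \<comment> \<open>Finiteness matters: an infinite level would also have \<open>card\<close>
      equal to 0.\<close>
    moreover have "f_vector D (card A) \<noteq> 0" using A fin by (auto simp: f_vector_def)
    ultimately show "m \<le> card A \<and> card A \<le> l" using D(2) by metis
  next
    fix i assume "m \<le> i" "i \<le> l"
    then show "card {A \<in> D. card A = i} = k" using D(2) assms(1) by (simp add: f_vector_def)
  qed
qed

lemma card_missing:
  assumes "cutset n C"
  shows "card {A. A \<subseteq> {1..n} \<and> card A = m \<and> A \<notin> C} + card {A \<in> C. card A = m} = n choose m"
proof -
  have "C \<subseteq> Pow {1..n}" using assms by (simp add: cutset_def)
  then have *: "{A. A \<subseteq> {1..n} \<and> card A = m} =
      {A. A \<subseteq> {1..n} \<and> card A = m \<and> A \<notin> C} \<union> {A \<in> C. card A = m}" (is "?L = ?R \<union> ?T")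
    by auto
  have "finite (?R \<union> ?T)" unfolding *[symmetric] by simp
  then have "card ?L = card ?R + card ?T" unfolding * by (intro card_Un_disjoint) auto
  then show ?thesis using n_subsets[of "{1..n}" m] by simp
qed

section \<open>One and two levels\<close>

lemma g_one_level:
  assumes "m \<le> n"
  shows "g n m m = n choose m"
proof (rule g_eqI[where C = "{A. A \<subseteq> {1..n} \<and> card A = m}"])
  show "cutset n {A. A \<subseteq> {1..n} \<and> card A = m}"
    unfolding cutset_def
  proof (intro conjI allI impI)
    fix M assume "maximal_chain n M"
    then obtain A where "A m \<subseteq> {1..n}" "card (A m) = m" "M = A ` {0..n}"
      using assms unfolding maximal_chain_def by blast
    then show "{A. A \<subseteq> {1..n} \<and> card A = m} \<inter> M \<noteq> {}" using assms by auto
  qed auto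
next
  fix i assume "m \<le> i" "i \<le> m"
  then show "card {A \<in> {A. A \<subseteq> {1..n} \<and> card A = m}. card A = i} = n choose m"
    using n_subsets[of "{1..n}" m] by simp
next
  fix C k
  assume C: "cutset n C" "\<And>A. A \<in> C \<Longrightarrow> m \<le> card A \<and> card A \<le> m"
    "\<And>i. m \<le> i \<Longrightarrow> i \<le> m \<Longrightarrow> card {A \<in> C. card A = i} = k"
  have "A \<in> C" if "A \<subseteq> {1..n}" "card A = m" for A
    \<comment> \<open>With the empty list the flag consists of \<open>A\<close> alone.\<close>
    using cutset_flag[OF C(1), of m "[]" A] C(2) that by auto
  then have "{A. A \<subseteq> {1..n} \<and> card A = m \<and> A \<notin> C} = {}" by auto
  then have "card {A. A \<subseteq> {1..n} \<and> card A = m \<and> A \<notin> C} = 0" by (metis card.empty)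
  then show "n choose m \<le> k" using card_missing[OF C(1), of m] C(3)[of m] by linarith
qed (use assms in auto)

lemma card_insert_image:
  assumes "\<And>A. A \<in> F \<Longrightarrow> x \<notin> A"
  shows "card (insert x ` F) = card F"
proof (rule card_image, rule inj_onI)
  fix A B assume "A \<in> F" "B \<in> F" "insert x A = insert x B"
  then show "A = B" using insert_ident assms by metis
qed

text \<open>If \<open>k\<close> were smaller, more than \<open>(n - 1) choose (m - 1)\<close> sets
  of size \<open>m\<close> would be missing. By symmetry this count is a one-term cascade of index
  \<open>n - m\<close>, whose shadow is \<open>(n - 1) choose m\<close>; that many sets would then
  lie in \<open>C\<close> on level \<open>m + 1\<close>.\<close>

lemma two_level_lower:
  assumes C: "cutset n C" "\<And>A. A \<in> C \<Longrightarrow> m \<le> card A \<and> card A \<le> m + 1"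
    "\<And>i. m \<le> i \<Longrightarrow> i \<le> m + 1 \<Longrightarrow> card {A \<in> C. card A = i} = k" and m: "m < n"
  shows "(n - 1) choose m \<le> k"
\<comment> \<open>For \<open>m = 0\<close> the claim is just that \<open>k\<close> is positive; the
  Pascal split used otherwise needs a genuine \<open>m - 1\<close>.\<close>
proof (cases "m = 0")
  case True
  have "finite C" using C(1) finite_subset[of C "Pow {1..n}"] by (auto simp: cutset_def)
  moreover have "\<exists>j\<le>length [1::nat]. {} \<union> set (take j [1]) \<in> C"
    by (rule cutset_flag[OF C(1), of m]) (use C(2) m True in auto)
  then obtain A where A: "A \<in> C" by blast
  ultimately have "card {B \<in> C. card B = card A} \<noteq> 0" by auto
  then have "k \<noteq> 0" using C(3) C(2)[OF A] by metis
  then show ?thesis using True by simp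
next
  case False
  define F where "F = {A. A \<subseteq> {1..n} \<and> card A = m \<and> A \<notin> C}"
  have F: "F \<subseteq> Pow {1..n}" "\<forall>A\<in>F. card A = m" by (auto simp: F_def)
  have cF: "card F + k = n choose m" using card_missing[OF C(1), of m] C(3)[of m] by (simp add: F_def)
  have "upshadow {1..n} F \<subseteq> {A \<in> C. card A = m + 1}"
  proof
    fix B assume "B \<in> upshadow {1..n} F"
    then obtain x where x: "B \<subseteq> {1..n}" "x \<in> B" "B - {x} \<in> F" by (auto simp: upshadow_def)
    have "\<exists>j\<le>length [x]. B - {x} \<union> set (take j [x]) \<in> C"
      by (rule cutset_flag[OF C(1), of m]) (use C(2) x in \<open>auto simp: F_def\<close>)
    then have "B - {x} \<in> C \<or> B \<in> C" using x(2) by (auto simp: le_Suc_eq insert_absorb)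
    moreover have "finite B" using x(1) finite_subset by blast
    then have "card B = card (B - {x}) + 1" using card_Suc_Diff1[OF _ x(2)] by simp
    ultimately show "B \<in> {A \<in> C. card A = m + 1}" using x by (auto simp: F_def)
  qed
  moreover have "finite {A \<in> C. card A = m + 1}"
    using C(1) finite_subset[of C "Pow {1..n}"] by (auto simp: cutset_def)
  ultimately have up: "card (upshadow {1..n} F) \<le> k" using C(3)[of "m + 1"] card_mono by force
  show ?thesis
  proof (rule ccontr)
    assume less: "\<not> (n - 1) choose m \<le> k"
    moreover have "n choose m = ((n - 1) choose (m - 1)) + ((n - 1) choose m)"
      using False m by (simp add: choose_reduce_nat)
    moreover have "(n - 1) choose (m - 1) = (n - 1) choose (n - m)"
      using False m binomial_symmetric[of "m - 1" "n - 1"] by simp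
    ultimately have "(n - 1) choose (n - m) \<le> card F" using cF by linarith
    moreover have "cascade (Suc (n - m - 1)) n (((n - 1) choose Suc (n - m - 1)) + 0) (((n - 1) choose (n - m - 1)) + 0)"
      by (rule cascade.step[OF cascade.empty]) (use False m in auto)
    moreover have "Suc (n - m - 1) = n - m" using m by simp
    ultimately have "(n - 1) choose (n - m - 1) \<le> card (upshadow {1..n} F)"
      using kruskal_katona_up[OF _ F, of n "(n - 1) choose (n - m)" "(n - 1) choose (n - m - 1)"] by simp
    moreover have "(n - 1) choose (n - m - 1) = (n - 1) choose m"
      using m binomial_symmetric[of m "n - 1"] by simp
    ultimately show False using up less by simp
  qed
qed

lemma g_two_levels:
  assumes "m < n"
  shows "g n m (m + 1) = (n - 1) choose m"
proof -
  define D where "D = {A. A \<subseteq> {1..n - 1} \<and> card A = m}"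
  define C where "C = D \<union> insert n ` D"
  have D: "finite A" "n \<notin> A" "A \<subseteq> {1..n}" "card A = m" "card (insert n A) = m + 1" if "A \<in> D" for A
  proof -
    show "finite A" using that finite_subset by (auto simp: D_def)
    show "n \<notin> A" "A \<subseteq> {1..n}" "card A = m" using that assms by (fastforce simp: D_def)+
    then show "card (insert n A) = m + 1" using \<open>finite A\<close> by simp
  qed
  have D1: "card A = m + 1" if "A \<in> insert n ` D" for A using that D(5) by blast
  have cD: "card D = (n - 1) choose m" using n_subsets[of "{1..n - 1}" m] by (simp add: D_def)
  show ?thesis
  proof (rule g_eqI)
    show "cutset n C"
      unfolding cutset_def
    proof (intro conjI allI impI)
      show "C \<subseteq> Pow {1..n}" using D assms by (force simp: C_def)
      fix M assume "maximal_chain n M"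
      then obtain A where A: "\<And>i. i \<le> n \<Longrightarrow> A i \<subseteq> {1..n} \<and> card (A i) = i"
        "\<And>i. i < n \<Longrightarrow> A i \<subset> A (Suc i)" "M = A ` {0..n}"
        unfolding maximal_chain_def by blast
      show "C \<inter> M \<noteq> {}"
      proof (cases "n \<in> A m")
        case False
        then have "A m \<subseteq> {1..n - 1}" using A(1)[of m] assms by (force simp: subset_iff less_Suc_eq_le le_eq_less_or_eq)
        then have "A m \<in> C" using A(1)[of m] assms by (simp add: C_def D_def)
        then show ?thesis using A(3) assms by auto
      next
        case True
        then have n: "n \<in> A (Suc m)" using A(2)[of m] assms by auto
        have "A (Suc m) - {n} \<subseteq> {1..n - 1}" using A(1)[of "Suc m"] assms by (force simp: subset_iff)
        moreover have "card (A (Suc m) - {n}) = m" using A(1)[of "Suc m"] assms n by simp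
        ultimately have "A (Suc m) - {n} \<in> D" by (simp add: D_def)
        moreover have "A (Suc m) = insert n (A (Suc m) - {n})" using n by blast
        ultimately have "A (Suc m) \<in> C" unfolding C_def by blast
        then show ?thesis using A(3) assms by auto
      qed
    qed
    show "m \<le> card A \<and> card A \<le> m + 1" if "A \<in> C" for A
      using that D(4) D1 unfolding C_def by fastforce
    show "card {A \<in> C. card A = i} = (n - 1) choose m" if "m \<le> i" "i \<le> m + 1" for i
    proof (cases "i = m")
      case True
      then have "\<And>A. A \<in> D \<Longrightarrow> card A = i" "\<And>A. A \<in> insert n ` D \<Longrightarrow> card A \<noteq> i"
        using D(4) D1 by simp_all
      then have "{A \<in> C. card A = i} = D" unfolding C_def by blast
      then show ?thesis using cD by simp
    next
      case False
      then have "i = m + 1" using that by simp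
      then have "\<And>A. A \<in> D \<Longrightarrow> card A \<noteq> i" "\<And>A. A \<in> insert n ` D \<Longrightarrow> card A = i"
        using D(4) D1 by simp_all
      then have "{A \<in> C. card A = i} = insert n ` D" unfolding C_def by blast
      then show ?thesis using cD card_insert_image[of D n] D(2) by simp
    qed
    show "(n - 1) choose m \<le> k" if "cutset n C" "\<And>A. A \<in> C \<Longrightarrow> m \<le> card A \<and> card A \<le> m + 1"
      "\<And>i. m \<le> i \<Longrightarrow> i \<le> m + 1 \<Longrightarrow> card {A \<in> C. card A = i} = k" for C k
      using two_level_lower[OF that] assms by blast
  qed (use assms in simp)
qed

section \<open>Three levels\<close>

text \<open>Keeping \<open>r\<close> fixed makes induction on \<open>m\<close> possible: one step
  adds one summand here and two points to the ground set.\<close>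

definition level_size :: "nat \<Rightarrow> nat \<Rightarrow> nat" where
  "level_size r m = (\<Sum>i\<le>m. (2 * i + r) choose i)"

lemma level_size_eq:
  assumes "n = 2 * m + r + 2"
  shows "(\<Sum>j=0..m. (n - 2 * j - 2) choose (m - j)) = level_size r m"
  unfolding level_size_def
proof (rule sum.reindex_bij_witness[of _ "\<lambda>i. m - i" "\<lambda>j. m - j"])
  fix j assume "j \<in> {0..m}"
  then have "n - 2 * j - 2 = 2 * (m - j) + r" using assms by auto
  then show "(2 * (m - j) + r) choose (m - j) = (n - 2 * j - 2) choose (m - j)" by simp
qed auto

text \<open>If \<open>k\<close> is below \<open>level_size r m\<close>, the sum on the right plus 1
  bounds the number of missing \<open>m\<close>-sets from below. The induction step applies Pascal's
  rule twice and reflects one of the three binomials.\<close>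

lemma binomial_level_size: "(2 * m + r + 2) choose m = level_size r m + (\<Sum>i=1..m. (2 * i + r + 1) choose (i + r + 2))"
proof (induction m)
  case (Suc m)
  have "(2 * m + r + 3) choose m = (2 * m + r + 3) choose (m + r + 3)"
    using binomial_symmetric[of m "2 * m + r + 3"] by (simp add: add.assoc)
  moreover have "(2 * Suc m + r + 2) choose Suc m =
      ((2 * m + r + 3) choose m) + ((2 * m + r + 2) choose m) + ((2 * m + r + 2) choose Suc m)"
    by (simp add: numeral_eq_Suc)
  moreover have "level_size r (Suc m) = level_size r m + ((2 * m + r + 2) choose Suc m)"
    by (simp add: level_size_def add_ac)
  moreover have "(\<Sum>i=1..Suc m. (2 * i + r + 1) choose (i + r + 2)) =
      (\<Sum>i=1..m. (2 * i + r + 1) choose (i + r + 2)) + ((2 * m + r + 3) choose (m + r + 3))"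
    by (simp add: numeral_eq_Suc)
  ultimately show ?case using Suc by linarith
qed (simp add: level_size_def)

text \<open>The index \<open>m + r + 2\<close> is the size of the complement of an
  \<open>m\<close>-set. The extra 1 is the lowest term, \<open>r + 2\<close> over
  \<open>r + 2\<close>, with shadow \<open>r + 2\<close>. The bound \<open>2 * m + r + 3\<close> is
  exactly the top entry that the next induction step puts in front.\<close>

lemma cascade_first:
  "cascade (m + r + 2) (2 * m + r + 3) ((\<Sum>i=1..m. (2 * i + r + 1) choose (i + r + 2)) + 1)
     ((\<Sum>i=1..m. (2 * i + r + 1) choose (i + r + 1)) + (r + 2))"
proof (induction m)
  case 0
  have "cascade (Suc (r + 1)) (r + 3) (((r + 2) choose Suc (r + 1)) + 0) (((r + 2) choose (r + 1)) + 0)"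
    by (rule cascade.step[OF cascade.empty]) auto
  moreover have "(r + 2) choose (r + 1) = r + 2" using binomial_symmetric[of 1 "r + 2"] by simp
  ultimately show ?case by simp
next
  case (Suc m)
  have "cascade (Suc (m + r + 2)) (2 * Suc m + r + 3)
     (((2 * m + r + 3) choose Suc (m + r + 2)) + ((\<Sum>i=1..m. (2 * i + r + 1) choose (i + r + 2)) + 1))
     (((2 * m + r + 3) choose (m + r + 2)) + ((\<Sum>i=1..m. (2 * i + r + 1) choose (i + r + 1)) + (r + 2)))"
    by (rule cascade.step[OF Suc]) auto
  then show ?case by (simp add: numeral_eq_Suc add_ac)
qed

text \<open>The counterpart one level higher, where complements have size \<open>m + r + 1\<close>;
  here the extra 1 is \<open>r + 1\<close> over \<open>r + 1\<close>.\<close>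

lemma cascade_second:
  "cascade (m + r + 1) (2 * m + r + 2) ((\<Sum>i=1..m. (2 * i + r) choose (i + r + 1)) + 1)
     ((\<Sum>i=1..m. (2 * i + r) choose (i + r)) + (r + 1))"
proof (induction m)
  case 0
  have "cascade (Suc r) (r + 2) (((r + 1) choose Suc r) + 0) (((r + 1) choose r) + 0)"
    by (rule cascade.step[OF cascade.empty]) auto
  then show ?case by simp
next
  case (Suc m)
  have "cascade (Suc (m + r + 1)) (2 * Suc m + r + 2)
     (((2 * m + r + 2) choose Suc (m + r + 1)) + ((\<Sum>i=1..m. (2 * i + r) choose (i + r + 1)) + 1))
     (((2 * m + r + 2) choose (m + r + 1)) + ((\<Sum>i=1..m. (2 * i + r) choose (i + r)) + (r + 1)))"
    by (rule cascade.step[OF Suc]) auto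
  then show ?case by (simp add: numeral_eq_Suc add_ac)
qed

text \<open>The reflected form in which the number appears in shadows; the 1 is the summand for
  \<open>i = 0\<close>.\<close>

lemma level_size_symmetric: "level_size r m = (\<Sum>i=1..m. (2 * i + r) choose (i + r)) + 1"
proof (induction m)
  case (Suc m)
  have "(2 * Suc m + r) choose Suc m = (2 * Suc m + r) choose (Suc m + r)"
    using binomial_symmetric[of "Suc m" "2 * Suc m + r"] by simp
  then show ?case using Suc by (simp add: level_size_def)
qed (simp add: level_size_def)

text \<open>Pascal's rule splits the shadow of the first cascade into the amount compared with
  \<open>k\<close> on level \<open>m + 1\<close> and the size of the second cascade, whose extra 1
  is covered by \<open>r + 1\<close>.\<close>

lemma shadow_first:
  "(\<Sum>i=1..m. (2 * i + r + 1) choose (i + r + 1)) + (r + 2) =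
     level_size r m + (\<Sum>i=1..m. (2 * i + r) choose (i + r + 1)) + (r + 1)"
proof -
  have "(\<Sum>i=1..m. (2 * i + r + 1) choose (i + r + 1)) =
      (\<Sum>i=1..m. ((2 * i + r) choose (i + r)) + ((2 * i + r) choose (i + r + 1)))"
    by (rule sum.cong) auto
  then show ?thesis by (simp add: level_size_symmetric sum.distrib)
qed

lemma upshadow_props:
  assumes "F \<subseteq> Pow X" "\<forall>A\<in>F. card A = m" "finite X"
  shows "upshadow X F \<subseteq> Pow X" "\<forall>B\<in>upshadow X F. card B = m + 1"
proof -
  have "card B = m + 1" if "B \<in> upshadow X F" for B
  proof -
    from that obtain x where x: "B \<subseteq> X" "x \<in> B" "B - {x} \<in> F" by (auto simp: upshadow_def)
    then have "finite B" using assms(3) finite_subset by blast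
    then show ?thesis using card_Suc_Diff1[OF _ x(2)] x(3) assms(2) by auto
  qed
  then show "\<forall>B\<in>upshadow X F. card B = m + 1" by blast
qed (auto simp: upshadow_def)

lemma three_level_lower:
  assumes C: "cutset n C" "\<And>A. A \<in> C \<Longrightarrow> m \<le> card A \<and> card A \<le> m + 2"
    "\<And>i. m \<le> i \<Longrightarrow> i \<le> m + 2 \<Longrightarrow> card {A \<in> C. card A = i} = k"
    and n: "n = 2 * m + r + 2"
  shows "level_size r m \<le> k"
proof (rule ccontr)
  assume less: "\<not> level_size r m \<le> k"
  have finC: "finite C" using C(1) finite_subset[of C "Pow {1..n}"] by (auto simp: cutset_def)
  define F where "F = {A. A \<subseteq> {1..n} \<and> card A = m \<and> A \<notin> C}"
  define G where "G = upshadow {1..n} F - C"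
  have F: "F \<subseteq> Pow {1..n}" "\<forall>A\<in>F. card A = m" by (auto simp: F_def)
  note UF = upshadow_props[OF F]
  have G: "G \<subseteq> Pow {1..n}" "\<forall>A\<in>G. card A = m + 1" using UF by (auto simp: G_def)
  note UG = upshadow_props[OF G]
  have "card F + k = n choose m" using card_missing[OF C(1), of m] C(3)[of m] by (simp add: F_def)
  then have cF: "(\<Sum>i=1..m. (2 * i + r + 1) choose (i + r + 2)) + 1 \<le> card F"
    using less binomial_level_size[of m r, folded n] by linarith
  have "card {1..n} - m = m + r + 2" using n by simp
  then have "cascade (card {1..n} - m) (2 * m + r + 3) ((\<Sum>i=1..m. (2 * i + r + 1) choose (i + r + 2)) + 1)
      (level_size r m + (\<Sum>i=1..m. (2 * i + r) choose (i + r + 1)) + (r + 1))"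
    using cascade_first[of m r] unfolding shadow_first by (simp only:)
  from kruskal_katona_up[OF _ F this cF] have "level_size r m + (\<Sum>i=1..m. (2 * i + r) choose (i + r + 1)) + (r + 1)
      \<le> card (upshadow {1..n} F)"
    by simp
  moreover have "card (upshadow {1..n} F) \<le> card G + k"
  proof -
    have sub: "upshadow {1..n} F \<subseteq> G \<union> {A \<in> C. card A = m + 1}" using UF by (auto simp: G_def)
    have "finite G" using G(1) finite_subset by fastforce
    then have "card (upshadow {1..n} F) \<le> card (G \<union> {A \<in> C. card A = m + 1})"
      using finC sub by (intro card_mono) auto
    also have "\<dots> \<le> card G + k" using C(3)[of "m + 1"] card_Un_le[of G "{A \<in> C. card A = m + 1}"] by simp
    finally show ?thesis .
  qed
  \<comment> \<open>At most \<open>k < level_size r m\<close> of these sets lie in \<open>C\<close>,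
    so the rest of the bound passes to \<open>G\<close>.\<close>
  ultimately have cG: "(\<Sum>i=1..m. (2 * i + r) choose (i + r + 1)) + 1 \<le> card G" using less by linarith
  have "card {1..n} - (m + 1) = m + r + 1" using n by simp
  then have "cascade (card {1..n} - (m + 1)) (2 * m + r + 2) ((\<Sum>i=1..m. (2 * i + r) choose (i + r + 1)) + 1)
      ((\<Sum>i=1..m. (2 * i + r) choose (i + r)) + (r + 1))"
    using cascade_second[of m r] by (simp only:)
  from kruskal_katona_up[OF _ G this cG] have "(\<Sum>i=1..m. (2 * i + r) choose (i + r)) + (r + 1) \<le> card (upshadow {1..n} G)"
    by simp
  then have "level_size r m \<le> card (upshadow {1..n} G)" by (simp add: level_size_symmetric)
  also have "\<dots> \<le> card {A \<in> C. card A = m + 2}"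
  proof (rule card_mono)
    show "finite {A \<in> C. card A = m + 2}" using finC by simp
    show "upshadow {1..n} G \<subseteq> {A \<in> C. card A = m + 2}"
    proof
      fix B assume B: "B \<in> upshadow {1..n} G"
      then obtain y where y: "B \<subseteq> {1..n}" "y \<in> B" "B - {y} \<in> G" by (auto simp: upshadow_def)
      \<comment> \<open>The flag \<open>B - {y} - {x}\<close>, \<open>B - {y}\<close>,
        \<open>B\<close> misses \<open>C\<close> in its first two sets, so \<open>C\<close> must
        contain \<open>B\<close>.\<close>
      then obtain x where x: "x \<in> B - {y}" "B - {y} - {x} \<in> F" by (auto simp: G_def upshadow_def)
      have "\<exists>j\<le>length [x, y]. (B - {y} - {x}) \<union> set (take j [x, y]) \<in> C"
        by (rule cutset_flag[OF C(1), of m]) (use C(2) x y in \<open>auto simp: F_def\<close>)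
      then obtain j where j: "j \<le> length [x, y]" "(B - {y} - {x}) \<union> set (take j [x, y]) \<in> C" by blast
      have 1: "(B - {y} - {x}) \<union> {x} = B - {y}" "(B - {y} - {x}) \<union> {x, y} = B" using x y by auto
      from j(1) have "j \<le> 2" by simp
      then consider "j = 0" | "j = 1" | "j = 2" by linarith
      then have "B \<in> C"
      proof cases
        assume "j = 0"
        then show ?thesis using j(2) x(2) by (simp add: F_def)
      next
        assume "j = 1"
        then have "(B - {y} - {x}) \<union> {x} \<in> C" using j(2) by simp
        then show ?thesis using 1 y(3) by (simp add: G_def)
      next
        assume "j = 2"
        then have "(B - {y} - {x}) \<union> {x, y} \<in> C" using j(2) by simp
        then show ?thesis using 1 by simp
      qed
      moreover have "card B = m + 2" using UG(2) B by auto
      ultimately show "B \<in> {A \<in> C. card A = m + 2}" by simp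
    qed
  qed
  also have "\<dots> = k" using C(3)[of "m + 2"] by simp
  finally show False using less by simp
qed

section \<open>Recursive construction of three-level cutsets\<close>

text \<open>Flags of three sets replace maximal chains, so that in the induction a point common to
  all three can simply be deleted. Levels are written \<open>m + j\<close> because this deletion
  lowers \<open>m\<close> and keeps \<open>j\<close>.\<close>

definition flag_family :: "nat \<Rightarrow> nat \<Rightarrow> nat set set \<Rightarrow> bool" where
  "flag_family r m C \<longleftrightarrow>
    (\<forall>A\<in>C. A \<subseteq> {1..2 * m + r + 2} \<and> m \<le> card A \<and> card A \<le> m + 2) \<and>
    (\<forall>j\<le>2. card {A \<in> C. card A = m + j} = level_size r m) \<and>
    (\<forall>A0 A1 A2. A0 \<subseteq> A1 \<longrightarrow> A1 \<subseteq> A2 \<longrightarrow> A2 \<subseteq> {1..2 * m + r + 2} \<longrightarrow> card A0 = m \<longrightarrow>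
      card A1 = m + 1 \<longrightarrow> card A2 = m + 2 \<longrightarrow> A0 \<in> C \<or> A1 \<in> C \<or> A2 \<in> C)"

lemma flag_familyD:
  assumes "flag_family r m C" "n = 2 * m + r + 2"
  shows "\<And>A. A \<in> C \<Longrightarrow> A \<subseteq> {1..n} \<and> m \<le> card A \<and> card A \<le> m + 2"
    "\<And>j. j \<le> 2 \<Longrightarrow> card {A \<in> C. card A = m + j} = level_size r m"
    "\<And>A0 A1 A2. A0 \<subseteq> A1 \<Longrightarrow> A1 \<subseteq> A2 \<Longrightarrow> A2 \<subseteq> {1..n} \<Longrightarrow> card A0 = m \<Longrightarrow>
      card A1 = m + 1 \<Longrightarrow> card A2 = m + 2 \<Longrightarrow> A0 \<in> C \<or> A1 \<in> C \<or> A2 \<in> C"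
  using assms(1) unfolding flag_family_def assms(2)[symmetric] by simp_all

lemma exists_flag_family: "\<exists>C. flag_family r m C"
proof (induction m)
  case 0
  \<comment> \<open>The empty set alone meets every flag; the other two sets bring each level to the
    required count 1.\<close>
  let ?C = "{{}, {1}, {1, 2::nat}}"
  have "card {A \<in> ?C. card A = j} = level_size r 0" if "j \<le> 2" for j
  proof -
    from that consider "j = 0" | "j = 1" | "j = 2" by linarith
    then have "{A \<in> ?C. card A = j} = {if j = 0 then {} else if j = 1 then {1} else {1, 2}}"
      by cases auto
    then show ?thesis by (simp add: level_size_def)
  qed
  moreover have "A0 = {}" if "A0 \<subseteq> A1" "A1 \<subseteq> A2" "A2 \<subseteq> {1..2 * 0 + r + 2}" "card A0 = 0"
    for A0 A1 A2
    using that by (meson card_0_eq finite_atLeastAtMost finite_subset)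
  ultimately show ?case unfolding flag_family_def by (intro exI[of _ ?C]) auto
next
  case (Suc m)
  define n where "n = 2 * m + r + 2"
  define v where "v = n + 1"
  define w where "w = n + 2"
  obtain C where "flag_family r m C" using Suc.IH by blast
  note C = flag_familyD[OF this n_def]
  have X: "{1..2 * Suc m + r + 2} = insert v (insert w {1..n})" by (auto simp: n_def v_def w_def)
  have vw: "v \<noteq> w" "v \<notin> {1..n}" "w \<notin> {1..n}" by (auto simp: v_def w_def)
  define D where "D = {B. B \<subseteq> {1..n} \<and> card B = m + 1}"
  define D1 where "D1 = insert v ` D"
  define D2 where "D2 = insert v ` (insert w ` D)"
  define E where "E = insert w ` C"
  define H where "H = D \<union> D1 \<union> D2 \<union> E"
  \<comment> \<open>Since \<open>n = 2 * Suc m + r\<close>, this is precisely the new summand of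
    \<open>level_size r (Suc m)\<close>; each of the three levels receives one copy of
    \<open>D\<close> and one level of \<open>C\<close>.\<close>
  have cD: "card D = (2 * Suc m + r) choose Suc m" using n_subsets[of "{1..n}" "m + 1"]
    by (simp add: D_def n_def)
  have fin: "finite B" if "B \<subseteq> {1..n}" for B using that finite_subset by blast
  have D: "A \<subseteq> {1..n}" "v \<notin> A" "w \<notin> A" "finite A" "card A = m + 1" if "A \<in> D" for A
    using that vw fin by (auto simp: D_def)
  have CC: "v \<notin> A" "w \<notin> A" "finite A" if "A \<in> C" for A using C(1)[OF that] vw fin by auto
  have D1: "card A = m + 2 \<and> v \<in> A \<and> w \<notin> A" if "A \<in> D1" for A using that D vw by (auto simp: D1_def)
  have D2: "card A = m + 3 \<and> v \<in> A \<and> w \<in> A" if "A \<in> D2" for A using that D vw by (auto simp: D2_def)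
  have E: "v \<notin> A \<and> w \<in> A \<and> m + 1 \<le> card A \<and> card A \<le> m + 3" if "A \<in> E" for A
    using that CC C(1) vw by (auto simp: E_def)
  have cD1: "card D1 = card D" unfolding D1_def by (rule card_insert_image) (use D in auto)
  have cD2: "card D2 = card D"
  proof -
    have "card D2 = card (insert w ` D)" unfolding D2_def by (rule card_insert_image) (use D vw in auto)
    also have "\<dots> = card D" by (rule card_insert_image) (use D in auto)
    finally show ?thesis .
  qed
  have finD: "finite D" by (simp add: D_def)
  have "C \<subseteq> Pow {1..n}" using C(1) by blast
  then have finC: "finite C" by (rule finite_subset) simp
  have cE: "card {A \<in> E. card A = m + 1 + j} = level_size r m" if "j \<le> 2" for j
  proof -
    have "{A \<in> E. card A = m + 1 + j} = insert w ` {A \<in> C. card A = m + j}"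
      using CC by (auto simp: E_def)
    moreover have "card (insert w ` {A \<in> C. card A = m + j}) = card {A \<in> C. card A = m + j}"
      by (rule card_insert_image) (use CC in auto)
    ultimately show ?thesis using C(2)[OF that] by simp
  qed
  have "card {A \<in> H. card A = Suc m + j} = level_size r (Suc m)" if j: "j \<le> 2" for j
  proof -
    define L where "L = (if j = 0 then D else if j = 1 then D1 else D2)"
    from j consider "j = 0" | "j = 1" | "j = 2" by linarith
    then have "{A \<in> H. card A = Suc m + j} = L \<union> {A \<in> E. card A = m + 1 + j}"
      by cases (use D D1 D2 in \<open>auto simp: L_def H_def\<close>)
    moreover have "L \<inter> {A \<in> E. card A = m + 1 + j} = {}"
    proof -
      have "w \<notin> A \<or> v \<in> A" if "A \<in> L" for A
        using that D(3) D1 D2 by (auto simp: L_def split: if_splits)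
      then show ?thesis using E by blast
    qed
    moreover have "finite L" using finD by (simp add: L_def D1_def D2_def)
    moreover have "finite {A \<in> E. card A = m + 1 + j}" using finC by (simp add: E_def)
    ultimately have "card {A \<in> H. card A = Suc m + j} = card L + level_size r m"
      by (simp only: card_Un_disjoint cE[OF j])
    moreover have "card L = card D" using cD1 cD2 by (simp add: L_def)
    ultimately show ?thesis using cD by (simp add: level_size_def)
  qed
  moreover have "A \<subseteq> {1..2 * Suc m + r + 2} \<and> Suc m \<le> card A \<and> card A \<le> Suc m + 2" if "A \<in> H" for A
  proof -
    have "A \<subseteq> {1..2 * Suc m + r + 2}" unfolding X
      using that D(1) C(1) by (auto simp: H_def D1_def D2_def E_def)
    then show ?thesis using that D D1 D2 E by (force simp: H_def)
  qed
  moreover have "A0 \<in> H \<or> A1 \<in> H \<or> A2 \<in> H"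
    if A: "A0 \<subseteq> A1" "A1 \<subseteq> A2" "A2 \<subseteq> {1..2 * Suc m + r + 2}" "card A0 = Suc m"
      "card A1 = Suc m + 1" "card A2 = Suc m + 2" for A0 A1 A2
  proof -
    have sub: "A2 \<subseteq> insert v (insert w {1..n})" "A1 \<subseteq> insert v (insert w {1..n})"
      "A0 \<subseteq> insert v (insert w {1..n})" using A X by auto
    have f: "finite A0" "finite A1" "finite A2" using A(4-6) by (auto intro: card_ge_0_finite)
    have top: "A2 \<in> H" if "v \<in> A2" "w \<in> A2"
    proof -
      have "card (A2 - {v} - {w}) = m + 1" using that vw f A(6) by simp
      then have "A2 - {v} - {w} \<in> D" using sub(1) by (auto simp: D_def)
      moreover have "A2 = insert v (insert w (A2 - {v} - {w}))" using that by auto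
      ultimately show ?thesis unfolding H_def D2_def by blast
    qed
    \<comment> \<open>If one of \<open>v\<close>, \<open>w\<close> is missing from
      \<open>A2\<close>, either the other is also missing from \<open>A0\<close> or it lies in all
      three sets. The cases are met by \<open>D2\<close>, \<open>D\<close>, \<open>D1\<close> and
      \<open>E\<close>, in this order.\<close>
    consider "v \<in> A2" "w \<in> A2" | "v \<notin> A0" "w \<notin> A0" | "v \<in> A0" "w \<notin> A2" | "v \<notin> A2" "w \<in> A0"
      using A by blast
    then show ?thesis
    proof cases
      case 1
      then show ?thesis using top by simp
    next
      case 2
      then have "A0 \<in> D" using sub(3) A(4) by (auto simp: D_def)
      then show ?thesis by (simp add: H_def)
    next
      case 3
      then have v: "v \<in> A1" "w \<notin> A1" using A by auto
      then have "card (A1 - {v}) = m + 1" using f A(5) by simp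
      then have "A1 - {v} \<in> D" using sub(2) v by (auto simp: D_def)
      moreover have "A1 = insert v (A1 - {v})" using v by auto
      ultimately show ?thesis unfolding H_def D1_def by blast
    next
      case 4
      then have w: "w \<in> A0" "w \<in> A1" "w \<in> A2" using A by auto
      have "A0 - {w} \<in> C \<or> A1 - {w} \<in> C \<or> A2 - {w} \<in> C"
        by (rule C(3)) (use A(1,2,4-6) w f sub 4 in auto)
      moreover have "B \<in> H" if "w \<in> B" "B - {w} \<in> C" for B
      proof -
        have "insert w (B - {w}) \<in> E" unfolding E_def using that(2) by (rule imageI)
        moreover have "insert w (B - {w}) = B" using that(1) by auto
        ultimately show ?thesis by (simp add: H_def)
      qed
      ultimately show ?thesis using w by meson
    qed
  qed
  ultimately have "flag_family r (Suc m) H" unfolding flag_family_def by simp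
  then show ?case by blast
qed

lemma g_three_levels:
  assumes n: "n = 2 * m + r + 2"
  shows "g n m (m + 2) = level_size r m"
proof -
  obtain C where "flag_family r m C" using exists_flag_family by blast
  note C = flag_familyD[OF this n]
  show ?thesis
  proof (rule g_eqI)
    show "m + 2 \<le> n" using n by simp
    show "cutset n C"
      unfolding cutset_def
    proof (intro conjI allI impI)
      show "C \<subseteq> Pow {1..n}" using C(1) by blast
      fix M assume "maximal_chain n M"
      then obtain A where A: "\<And>i. i \<le> n \<Longrightarrow> A i \<subseteq> {1..n} \<and> card (A i) = i"
        "\<And>i. i < n \<Longrightarrow> A i \<subset> A (Suc i)" "M = A ` {0..n}"
        unfolding maximal_chain_def by blast
      have "A m \<in> C \<or> A (m + 1) \<in> C \<or> A (m + 2) \<in> C"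
        by (rule C(3)) (use A(1)[of m] A(1)[of "m + 1"] A(1)[of "m + 2"] A(2)[of m] A(2)[of "m + 1"] n in auto)
      moreover have "A m \<in> M" "A (m + 1) \<in> M" "A (m + 2) \<in> M" using A(3) n by auto
      ultimately show "C \<inter> M \<noteq> {}" by blast
    qed
    show "m \<le> card A \<and> card A \<le> m + 2" if "A \<in> C" for A using C(1)[OF that] by simp
    show "card {A \<in> C. card A = i} = level_size r m" if "m \<le> i" "i \<le> m + 2" for i
      using C(2)[of "i - m"] that by simp
    show "level_size r m \<le> k" if "cutset n C" "\<And>A. A \<in> C \<Longrightarrow> m \<le> card A \<and> card A \<le> m + 2"
      "\<And>i. m \<le> i \<Longrightarrow> i \<le> m + 2 \<Longrightarrow> card {A \<in> C. card A = i} = k" for C k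
      using three_level_lower[OF that n] .
  qed
qed

theorem theorem1:
  fixes n :: nat
  assumes "n \<ge> 1"
  shows "(\<forall>m::nat. m \<le> n \<longrightarrow> g n m m = n choose m) \<and>
    (\<forall>m::nat. m \<le> n - 1 \<longrightarrow> g n m (m + 1) = (n - 1) choose m) \<and>
    (\<forall>m::nat. real m \<le> real n / 2 - 1 \<longrightarrow>
       g n m (m + 2) = (\<Sum>j=0..m. (n - 2 * j - 2) choose (m - j)))"
proof (intro conjI allI impI)
  fix m assume "m \<le> n"
  then show "g n m m = n choose m" by (rule g_one_level)
next
  fix m assume "m \<le> n - 1"
  then show "g n m (m + 1) = (n - 1) choose m" using assms by (intro g_two_levels) simp
next
  fix m assume "real m \<le> real n / 2 - 1"
  \<comment> \<open>Over the reals the subtraction does not truncate, so this also excludes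
    \<open>n < 2\<close> and makes \<open>r\<close> a natural number.\<close>
  then have "2 * m + 2 \<le> n" by linarith
  then obtain r where r: "n = 2 * m + r + 2" by (metis add.assoc add.commute le_Suc_ex)
  then show "g n m (m + 2) = (\<Sum>j=0..m. (n - 2 * j - 2) choose (m - j))"
    using g_three_levels level_size_eq by metis
qed

end
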